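(* Every median geodesic metric space is Morse dichotomous.
   Context: A metric space $X$ is median if for all $x,y,z\in X$ there is a unique point $m$ with $d(u,m)+d(m,v)=d(u,v)$ for every pair $u,v\in\{x,y,z\}$. A $(Q,q)$-quasi-geodesic ($Q\ge1,q\ge0$) is a map $\gamma:I\to X$, $I\subseteq\mathbb R$ an interval, with $\frac1Q|t_1-t_2|-q\le d(\gamma(t_1),\gamma(t_2))\le Q|t_1-t_2|+q$. Convention: quasi-geodesics are assumed improved, i.e. continuous and such that the length of $\gamma|_{[t,t']}$ is at most $k_1d(\gamma(t),\gamma(t'))+k_2$, where $q'=2(Q+q)$, $k_1=Q(Q+q)$, $k_2=(Qq'+3)(Q+q)$. A Morse gauge is a function $M:\mathbb R_{\ge1}\times\mathbb R_{\ge0}\to\mathbb R_{\ge0}$, non-decreasing in each variable and continuous in the second. A (quasi-)geodesic $\gamma$ is $M$-Morse if every $(Q,q)$-quasi-geodesic with endpoints $\gamma(s),\gamma(t)$ lies in the $M(Q,q)$-neighbourhood of $\gamma|_{[s,t]}$. A quasi-geodesic $\gamma$ is $C$-(strongly) contracting if for each ball $B$ disjoint from $\gamma$, $\mathrm{diam}(\pi_\gamma(B))\le C$, where $\pi_\gamma:X\to2^\gamma$ is the closest point projection. $X$ is Morse dichotomous if for every Morse gauge $M$ there is $C$ such that all $M$-Morse geodesics are $C$-strongly contracting. *)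

theory Defs
  imports "HOL-Analysis.Analysis"
begin

text \<open>The three pairs are \<open>{x,y}\<close>, \<open>{y,z}\<close>, \<open>{z,x}\<close>, also when some of the three points coincide.\<close>

definition median_space :: "'a::metric_space itself \<Rightarrow> bool" where
  "median_space _ \<longleftrightarrow>
     (\<forall>x y z :: 'a. \<exists>!m.
        dist x m + dist m y = dist x y \<and>
        dist y m + dist m z = dist y z \<and>
        dist z m + dist m x = dist z x)"

definition geodesic :: "real set \<Rightarrow> (real \<Rightarrow> 'a::metric_space) \<Rightarrow> bool" where
  "geodesic I \<gamma> \<longleftrightarrow> is_interval I \<and> (\<forall>s\<in>I. \<forall>t\<in>I. dist (\<gamma> s) (\<gamma> t) = \<bar>s - t\<bar>)"

definition geodesic_space :: "'a::metric_space itself \<Rightarrow> bool" where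
  "geodesic_space _ \<longleftrightarrow>
     (\<forall>x y :: 'a. \<exists>\<gamma> a b. a \<le> b \<and> geodesic {a..b} \<gamma> \<and> \<gamma> a = x \<and> \<gamma> b = y)"

text \<open>Length of \<open>\<gamma>\<close> restricted to \<open>{a..b}\<close>: the supremum of the lengths of inscribed
  polygonal chains, a partition being a sorted list of points of \<open>{a..b}\<close>.\<close>

definition curve_length :: "real \<Rightarrow> real \<Rightarrow> (real \<Rightarrow> 'a::metric_space) \<Rightarrow> ennreal" where
  "curve_length a b \<gamma> =
     (SUP ts \<in> {ts. sorted ts \<and> set ts \<subseteq> {a..b}}.
        \<Sum>i<length ts - 1. ennreal (dist (\<gamma> (ts ! i)) (\<gamma> (ts ! Suc i))))"

definition quasi_geodesic ::
  "real \<Rightarrow> real \<Rightarrow> real set \<Rightarrow> (real \<Rightarrow> 'a::metric_space) \<Rightarrow> bool" where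
  "quasi_geodesic Q q I \<gamma> \<longleftrightarrow> 1 \<le> Q \<and> 0 \<le> q \<and> is_interval I \<and>
     (\<forall>t1\<in>I. \<forall>t2\<in>I.
        1 / Q * \<bar>t1 - t2\<bar> - q \<le> dist (\<gamma> t1) (\<gamma> t2) \<and>
        dist (\<gamma> t1) (\<gamma> t2) \<le> Q * \<bar>t1 - t2\<bar> + q)"

definition improved_quasi_geodesic ::
  "real \<Rightarrow> real \<Rightarrow> real set \<Rightarrow> (real \<Rightarrow> 'a::metric_space) \<Rightarrow> bool" where
  "improved_quasi_geodesic Q q I \<gamma> \<longleftrightarrow>
     quasi_geodesic Q q I \<gamma> \<and> continuous_on I \<gamma> \<and>
     (let q' = 2 * (Q + q); k1 = Q * (Q + q); k2 = (Q * q' + 3) * (Q + q) in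
      \<forall>t\<in>I. \<forall>t'\<in>I. t \<le> t' \<longrightarrow>
        curve_length t t' \<gamma> \<le> ennreal (k1 * dist (\<gamma> t) (\<gamma> t') + k2))"

text \<open>A Morse gauge is a function on \<open>{1..} \<times> {0..}\<close>; values outside this domain are irrelevant.\<close>

definition morse_gauge :: "(real \<Rightarrow> real \<Rightarrow> real) \<Rightarrow> bool" where
  "morse_gauge M \<longleftrightarrow>
     (\<forall>Q\<ge>1. \<forall>q\<ge>0. 0 \<le> M Q q) \<and>
     (\<forall>q\<ge>0. mono_on {1..} (\<lambda>Q. M Q q)) \<and>
     (\<forall>Q\<ge>1. mono_on {0..} (M Q)) \<and>
     (\<forall>Q\<ge>1. continuous_on {0..} (M Q))"

text \<open>Quasi-geodesics are improved throughout, and neighbourhoods are closed (a gauge may vanish).\<close>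

definition morse ::
  "(real \<Rightarrow> real \<Rightarrow> real) \<Rightarrow> real set \<Rightarrow> (real \<Rightarrow> 'a::metric_space) \<Rightarrow> bool" where
  "morse M I \<gamma> \<longleftrightarrow>
     (\<forall>Q\<ge>1. \<forall>q\<ge>0. \<forall>s\<in>I. \<forall>t\<in>I. s \<le> t \<longrightarrow>
        (\<forall>a b \<eta>. a \<le> b \<and> improved_quasi_geodesic Q q {a..b} \<eta> \<and> \<eta> a = \<gamma> s \<and> \<eta> b = \<gamma> t \<longrightarrow>
           (\<forall>u\<in>{a..b}. infdist (\<eta> u) (\<gamma> ` {s..t}) \<le> M Q q)))"

definition closest_points :: "'a::metric_space set \<Rightarrow> 'a \<Rightarrow> 'a set" where
  "closest_points S x = {p \<in> S. dist x p = infdist x S}"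

text \<open>Boundedness is explicit because \<^const>\<open>diameter\<close> is only meaningful for bounded sets.\<close>

definition strongly_contracting ::
  "real \<Rightarrow> real set \<Rightarrow> (real \<Rightarrow> 'a::metric_space) \<Rightarrow> bool" where
  "strongly_contracting C I \<gamma> \<longleftrightarrow>
     (\<forall>x r. ball x r \<inter> \<gamma> ` I = {} \<longrightarrow>
        bounded (\<Union>y\<in>ball x r. closest_points (\<gamma> ` I) y) \<and>
        diameter (\<Union>y\<in>ball x r. closest_points (\<gamma> ` I) y) \<le> C)"

definition morse_dichotomous :: "'a::metric_space itself \<Rightarrow> bool" where
  "morse_dichotomous _ \<longleftrightarrow>
     (\<forall>M. morse_gauge M \<longrightarrow>
        (\<exists>C. \<forall>I (\<gamma> :: real \<Rightarrow> 'a). geodesic I \<gamma> \<and> morse M I \<gamma> \<longrightarrow> strongly_contracting C I \<gamma>))"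

end

theory Submission
  imports Defs
begin

text \<open>
  Let \<open>p\<close> be a nearest point to \<open>x\<close> on a Morse geodesic \<open>\<Gamma>\<close> and let \<open>z\<close> lie on \<open>\<Gamma>\<close>. The median
  \<open>m\<close> of \<open>x, p, z\<close> lies on a geodesic from \<open>p\<close> to \<open>z\<close>, hence near \<open>\<Gamma>\<close>, and since \<open>p\<close> is nearest,
  \<open>m\<close> is near \<open>p\<close>. So \<open>p\<close> is a coarse gate: \<open>d(x,z) \<ge> d(x,p) + d(p,z) - 2E\<close>. If \<open>p, q\<close> are gates
  of \<open>x, y\<close>, \<open>L = d(p,q)\<close> and \<open>d(x,y) < d(x,p)\<close>, medians give points \<open>x', y'\<close> above \<open>p, q\<close> at
  height about \<open>L/2\<close> with \<open>d(x',y') \<le> L\<close>. Three sides of the coarse \<open>\<ell>\<^sup>1\<close> rectangle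
  \<open>p, x', y', q\<close> then form a quasi-geodesic with constants depending only on \<open>E\<close>, so the Morse
  property bounds its height, and with it \<open>L\<close>.
\<close>

section \<open>Length and improvedness of 1-Lipschitz paths\<close>

lemma curve_length_le_of_lipschitz:
  assumes lip: "\<And>s t. s \<in> {a..b} \<Longrightarrow> t \<in> {a..b} \<Longrightarrow> dist (\<gamma> s) (\<gamma> t) \<le> \<bar>s - t\<bar>"
    and "a \<le> b"
  shows "curve_length a b \<gamma> \<le> ennreal (b - a)"
  unfolding curve_length_def
proof (rule SUP_least)
  fix ts :: "real list"
  assume "ts \<in> {ts. sorted ts \<and> set ts \<subseteq> {a..b}}"
  then have so: "sorted ts" and sub: "set ts \<subseteq> {a..b}" by auto
  have "(\<Sum>i<length ts - 1. ennreal (dist (\<gamma> (ts ! i)) (\<gamma> (ts ! Suc i))))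
      = ennreal (\<Sum>i<length ts - 1. dist (\<gamma> (ts ! i)) (\<gamma> (ts ! Suc i)))"
    by simp
  also have "\<dots> \<le> ennreal (b - a)"
  proof (rule ennreal_leI)
    have "(\<Sum>i<length ts - 1. dist (\<gamma> (ts ! i)) (\<gamma> (ts ! Suc i)))
        \<le> (\<Sum>i<length ts - 1. ts ! Suc i - ts ! i)"
    proof (rule sum_mono)
      fix i assume "i \<in> {..<length ts - 1}"
      then have i: "i < length ts" "Suc i < length ts" by auto
      then have "ts ! i \<in> {a..b}" "ts ! Suc i \<in> {a..b}" using sub nth_mem by blast+
      then have "dist (\<gamma> (ts ! i)) (\<gamma> (ts ! Suc i)) \<le> \<bar>ts ! i - ts ! Suc i\<bar>" by (rule lip)
      moreover have "ts ! i \<le> ts ! Suc i" using so i by (simp add: sorted_nth_mono)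
      ultimately show "dist (\<gamma> (ts ! i)) (\<gamma> (ts ! Suc i)) \<le> ts ! Suc i - ts ! i" by simp
    qed
    also have "\<dots> = ts ! (length ts - 1) - ts ! 0"
      by (rule sum_lessThan_telescope)
    also have "\<dots> \<le> b - a"
    \<comment> \<open>For the empty list, truncated subtraction makes both indices 0, so the
      difference vanishes whatever \<open>ts ! 0\<close> is.\<close>
    proof (cases "ts = []")
      case False
      then have "ts ! (length ts - 1) \<in> {a..b}" "ts ! 0 \<in> {a..b}"
        using sub by (metis diff_less length_greater_0_conv nth_mem subsetD zero_less_one)+
      then show ?thesis by auto
    qed (use \<open>a \<le> b\<close> in simp)
    finally show "(\<Sum>i<length ts - 1. dist (\<gamma> (ts ! i)) (\<gamma> (ts ! Suc i))) \<le> b - a" .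
  qed
  finally show "(\<Sum>i<length ts - 1. ennreal (dist (\<gamma> (ts ! i)) (\<gamma> (ts ! Suc i)))) \<le> ennreal (b - a)" .
qed

text \<open>Improvedness comes for free: the length over \<open>{s..t}\<close> is at most
  \<open>t - s\<close>, hence at most \<open>Q * dist + Q * q\<close>, and
  \<open>1 \<le> Q + q\<close> makes this smaller than the prescribed bound.\<close>

lemma improved_quasi_geodesic_of_lipschitz:
  assumes Q: "1 \<le> Q" and q: "0 \<le> q"
    and upper: "\<And>s t. a \<le> s \<Longrightarrow> s \<le> t \<Longrightarrow> t \<le> b \<Longrightarrow> dist (\<gamma> s) (\<gamma> t) \<le> t - s"
    and lower: "\<And>s t. a \<le> s \<Longrightarrow> s \<le> t \<Longrightarrow> t \<le> b \<Longrightarrow> t - s \<le> Q * (dist (\<gamma> s) (\<gamma> t) + q)"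
  shows "improved_quasi_geodesic Q q {a..b} \<gamma>"
proof -
  have lip: "dist (\<gamma> s) (\<gamma> t) \<le> \<bar>s - t\<bar>" if "s \<in> {a..b}" "t \<in> {a..b}" for s t
    using upper[of s t] upper[of t s] that by (cases "s \<le> t") (auto simp: dist_commute)
  have low: "\<bar>s - t\<bar> \<le> Q * (dist (\<gamma> s) (\<gamma> t) + q)" if "s \<in> {a..b}" "t \<in> {a..b}" for s t
    using lower[of s t] lower[of t s] that by (cases "s \<le> t") (auto simp: dist_commute)
  have "quasi_geodesic Q q {a..b} \<gamma>"
    unfolding quasi_geodesic_def
  proof (intro conjI ballI Q q)
    show "is_interval {a..b}" by (simp add: is_interval_cc)
    fix s t assume st: "s \<in> {a..b}" "t \<in> {a..b}"
    show "1 / Q * \<bar>s - t\<bar> - q \<le> dist (\<gamma> s) (\<gamma> t)"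
      using low[OF st] Q by (simp add: field_simps)
    have "\<bar>s - t\<bar> \<le> Q * \<bar>s - t\<bar>" using mult_right_mono[OF Q, of "\<bar>s - t\<bar>"] by simp
    from order_trans[OF lip[OF st] this]
    show "dist (\<gamma> s) (\<gamma> t) \<le> Q * \<bar>s - t\<bar> + q" using q by (rule add_increasing2[rotated])
  qed
  moreover have "continuous_on {a..b} \<gamma>"
    unfolding continuous_on_iff
  proof (intro ballI allI impI)
    fix s and e :: real assume s: "s \<in> {a..b}" and "0 < e"
    have "\<forall>t\<in>{a..b}. dist t s < e \<longrightarrow> dist (\<gamma> t) (\<gamma> s) < e"
      using lip s unfolding dist_real_def by (meson le_less_trans)
    then show "\<exists>d>0. \<forall>t\<in>{a..b}. dist t s < d \<longrightarrow> dist (\<gamma> t) (\<gamma> s) < e"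
      using \<open>0 < e\<close> by blast
  qed
  moreover have "curve_length s t \<gamma> \<le>
      ennreal (Q * (Q + q) * dist (\<gamma> s) (\<gamma> t) + (Q * (2 * (Q + q)) + 3) * (Q + q))"
    if st: "s \<in> {a..b}" "t \<in> {a..b}" "s \<le> t" for s t
  proof -
    have "curve_length s t \<gamma> \<le> ennreal (t - s)"
      using st by (intro curve_length_le_of_lipschitz lip) auto
    also have "\<dots> \<le> ennreal (Q * (Q + q) * dist (\<gamma> s) (\<gamma> t) + (Q * (2 * (Q + q)) + 3) * (Q + q))"
    proof (rule ennreal_leI)
      have "Q * 1 * dist (\<gamma> s) (\<gamma> t) \<le> Q * (Q + q) * dist (\<gamma> s) (\<gamma> t)"
        using Q q by (intro mult_right_mono mult_left_mono) auto
      moreover have "Q * q * 1 \<le> (Q * (2 * (Q + q)) + 3) * (Q + q)"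
      proof (rule mult_mono)
        have "Q * q \<le> Q * (2 * (Q + q))" using Q q by (intro mult_left_mono) auto
        then show "Q * q \<le> Q * (2 * (Q + q)) + 3" by simp
      qed (use Q q in auto)
      moreover have "t - s \<le> Q * dist (\<gamma> s) (\<gamma> t) + Q * q"
        using low[OF st(1,2)] st(3) by (simp add: distrib_left)
      ultimately show "t - s \<le> Q * (Q + q) * dist (\<gamma> s) (\<gamma> t) + (Q * (2 * (Q + q)) + 3) * (Q + q)"
        by simp
    qed
    finally show ?thesis .
  qed
  ultimately show ?thesis
    unfolding improved_quasi_geodesic_def by (simp add: Let_def)
qed

section \<open>Broken geodesics with three sides\<close>

lemma geodesic_space_unit_speed_path:
  fixes x y :: "'a::metric_space"
  assumes "geodesic_space TYPE('a)"
  obtains g where "g c = x" "g (c + dist x y) = y"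
    "\<And>s t. c \<le> s \<Longrightarrow> s \<le> t \<Longrightarrow> t \<le> c + dist x y \<Longrightarrow> dist (g s) (g t) = t - s"
proof -
  obtain \<gamma> a b where *: "a \<le> b" "geodesic {a..b} \<gamma>" "\<gamma> a = x" "\<gamma> b = y"
    using assms unfolding geodesic_space_def by blast
  have D: "dist (\<gamma> s) (\<gamma> t) = \<bar>s - t\<bar>" if "s \<in> {a..b}" "t \<in> {a..b}" for s t
    using *(2) that unfolding geodesic_def by blast
  have b: "b = a + dist x y" using D[of a b] * by auto
  show thesis
    by (rule that[of "\<lambda>t. \<gamma> (t - c + a)"]) (use * D b in \<open>auto simp: add.commute\<close>)
qed

text \<open>At unit speed the concatenation is 1-Lipschitz. For the lower bound, points on one side
  are exact, adjacent sides are controlled by the corner defects \<open>k1\<close> and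
  \<open>k2\<close>, and opposite sides by \<open>far\<close>. The latter ranges over all points
  metrically between two corners because the sides are chosen only inside the proof.\<close>

lemma broken_geodesic:
  fixes x0 x1 x2 x3 :: "'a::metric_space"
  assumes G: "geodesic_space TYPE('a)" and Q: "1 \<le> Q" and k: "0 \<le> k"
    and k1: "dist x0 x1 + dist x1 x2 \<le> dist x0 x2 + k"
    and k2: "dist x1 x2 + dist x2 x3 \<le> dist x1 x3 + k"
    and far: "\<And>u v. dist x0 u + dist u x1 = dist x0 x1 \<Longrightarrow> dist x2 v + dist v x3 = dist x2 x3 \<Longrightarrow>
      dist u x1 + dist x1 x2 + dist x2 v \<le> Q * (dist u v + k)"
  obtains b \<eta> where "0 \<le> b" "improved_quasi_geodesic Q k {0..b} \<eta>" "\<eta> 0 = x0" "\<eta> b = x3"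
    "x1 \<in> \<eta> ` {0..b}" "x2 \<in> \<eta> ` {0..b}"
proof -
  define l where "l = dist x0 x1"
  define m where "m = l + dist x1 x2"
  define n where "n = m + dist x2 x3"
  have lmn: "0 \<le> l" "l \<le> m" "m \<le> n" by (auto simp: l_def m_def n_def)
  obtain f where f: "f 0 = x0" "f l = x1"
    "\<And>s t. 0 \<le> s \<Longrightarrow> s \<le> t \<Longrightarrow> t \<le> l \<Longrightarrow> dist (f s) (f t) = t - s"
    using geodesic_space_unit_speed_path[OF G, of 0 x0 x1] by (auto simp: l_def)
  obtain g where g: "g l = x1" "g m = x2"
    "\<And>s t. l \<le> s \<Longrightarrow> s \<le> t \<Longrightarrow> t \<le> m \<Longrightarrow> dist (g s) (g t) = t - s"
    using geodesic_space_unit_speed_path[OF G, of l x1 x2] by (auto simp: m_def)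
  obtain h where h: "h m = x2" "h n = x3"
    "\<And>s t. m \<le> s \<Longrightarrow> s \<le> t \<Longrightarrow> t \<le> n \<Longrightarrow> dist (h s) (h t) = t - s"
    using geodesic_space_unit_speed_path[OF G, of m x2 x3] by (auto simp: n_def)
  define \<eta> where "\<eta> t = (if t \<le> l then f t else if t \<le> m then g t else h t)" for t
  have \<eta>f: "\<eta> t = f t" if "t \<le> l" for t using that by (simp add: \<eta>_def)
  have \<eta>g: "\<eta> t = g t" if "l \<le> t" "t \<le> m" for t
    using that f g by (cases "t = l") (auto simp: \<eta>_def)
  have \<eta>h: "\<eta> t = h t" if "m \<le> t" for t
  proof (cases "t = m")
    case True
    then show ?thesis using \<eta>g[of m] g h lmn by simp
  qed (use that lmn in \<open>auto simp: \<eta>_def\<close>)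
  have pts: "\<eta> 0 = x0" "\<eta> l = x1" "\<eta> m = x2" "\<eta> n = x3"
    using \<eta>f[of 0] \<eta>f[of l] \<eta>g[of m] \<eta>h[of n] f g h lmn by auto
  have d1: "dist (\<eta> s) (\<eta> t) = t - s" if "0 \<le> s" "s \<le> t" "t \<le> l" for s t
    using that f(3) by (simp add: \<eta>f)
  have d2: "dist (\<eta> s) (\<eta> t) = t - s" if "l \<le> s" "s \<le> t" "t \<le> m" for s t
    using that g(3) by (simp add: \<eta>g)
  have d3: "dist (\<eta> s) (\<eta> t) = t - s" if "m \<le> s" "s \<le> t" "t \<le> n" for s t
    using that h(3) by (simp add: \<eta>h)
  have bounds: "dist (\<eta> s) (\<eta> t) \<le> t - s \<and> t - s \<le> Q * (dist (\<eta> s) (\<eta> t) + k)"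
    if st: "0 \<le> s" "s \<le> t" "t \<le> n" for s t
  proof -
    have Qk: "z \<le> Q * (dist (\<eta> s) (\<eta> t) + k)" if "z \<le> dist (\<eta> s) (\<eta> t) + k" for z
    proof -
      have "dist (\<eta> s) (\<eta> t) + k \<le> Q * (dist (\<eta> s) (\<eta> t) + k)"
        using mult_right_mono[OF Q, of "dist (\<eta> s) (\<eta> t) + k"] k by simp
      with that show ?thesis by (rule order_trans)
    qed
    consider "t \<le> l" | "l \<le> s" "t \<le> m" | "m \<le> s" | "s \<le> l" "l \<le> t" "t \<le> m"
      | "l \<le> s" "s \<le> m" "m \<le> t" | "s \<le> l" "m \<le> t" by linarith
    then show ?thesis
    proof cases
      case 1
      then show ?thesis using d1[of s t] st k Qk[of "t - s"] by simp
    next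
      case 2
      then show ?thesis using d2[of s t] st k Qk[of "t - s"] by simp
    next
      case 3
      then show ?thesis using d3[of s t] st k Qk[of "t - s"] by simp
    next
      case 4
      have "dist (\<eta> s) x1 = l - s" "dist x1 (\<eta> t) = t - l" "dist x0 (\<eta> s) = s"
        "dist (\<eta> t) x2 = m - t"
        using 4 st d1[of s l] d2[of l t] d1[of 0 s] d2[of t m] pts by auto
      \<comment> \<open>Shortening both sides at the corner \<open>x1\<close> does not increase its
        defect: comparison with \<open>k1\<close> gives
        \<open>t - s \<le> dist (\<eta> s) (\<eta> t) + k\<close>.\<close>
      moreover have "dist x0 x2 \<le> dist x0 (\<eta> s) + dist (\<eta> s) (\<eta> t) + dist (\<eta> t) x2"
        "dist (\<eta> s) (\<eta> t) \<le> dist (\<eta> s) x1 + dist x1 (\<eta> t)"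
        by metric+
      ultimately show ?thesis using Qk[of "t - s"] k1 by (simp add: l_def m_def)
    next
      case 5
      have "dist x1 (\<eta> s) = s - l" "dist (\<eta> s) x2 = m - s" "dist x2 (\<eta> t) = t - m"
        "dist (\<eta> t) x3 = n - t"
        using 5 st d2[of l s] d2[of s m] d3[of m t] d3[of t n] pts by auto
      moreover have "dist x1 x3 \<le> dist x1 (\<eta> s) + dist (\<eta> s) (\<eta> t) + dist (\<eta> t) x3"
        "dist (\<eta> s) (\<eta> t) \<le> dist (\<eta> s) x2 + dist x2 (\<eta> t)"
        by metric+
      ultimately show ?thesis using Qk[of "t - s"] k2 by (simp add: m_def n_def)
    next
      case 6
      have e: "dist x0 (\<eta> s) = s" "dist (\<eta> s) x1 = l - s" "dist x2 (\<eta> t) = t - m"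
        "dist (\<eta> t) x3 = n - t"
        using 6 st d1[of 0 s] d1[of s l] d3[of m t] d3[of t n] pts by auto
      have "dist (\<eta> s) x1 + dist x1 x2 + dist x2 (\<eta> t) \<le> Q * (dist (\<eta> s) (\<eta> t) + k)"
        by (rule far) (use e in \<open>auto simp: l_def n_def\<close>)
      moreover have "dist (\<eta> s) (\<eta> t) \<le> dist (\<eta> s) x1 + dist x1 x2 + dist x2 (\<eta> t)"
        by metric
      ultimately show ?thesis using e by (simp add: m_def)
    qed
  qed
  show thesis
  proof (rule that)
    show "improved_quasi_geodesic Q k {0..n} \<eta>"
      using bounds by (intro improved_quasi_geodesic_of_lipschitz Q k) auto
    show "x1 \<in> \<eta> ` {0..n}" "x2 \<in> \<eta> ` {0..n}"
      using lmn pts by (auto intro: image_eqI[of _ _ l] image_eqI[of _ _ m])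
  qed (use lmn pts in auto)
qed

text \<open>The Morse property demands endpoints in the order of the parameters of
  \<open>\<gamma>\<close>. In the wrong order the path is traversed backwards, which swaps
  \<open>k1\<close> with \<open>k2\<close> and \<open>x1\<close> with \<open>x2\<close> and
  preserves \<open>far\<close>.\<close>

lemma morse_broken_geodesic:
  fixes x0 x1 x2 x3 :: "'a::metric_space"
  assumes G: "geodesic_space TYPE('a)" and mo: "morse M I \<gamma>"
    and Q: "1 \<le> Q" and k: "0 \<le> k"
    and x0: "x0 \<in> \<gamma> ` I" and x3: "x3 \<in> \<gamma> ` I"
    and k1: "dist x0 x1 + dist x1 x2 \<le> dist x0 x2 + k"
    and k2: "dist x1 x2 + dist x2 x3 \<le> dist x1 x3 + k"
    and far: "\<And>u v. dist x0 u + dist u x1 = dist x0 x1 \<Longrightarrow> dist x2 v + dist v x3 = dist x2 x3 \<Longrightarrow>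
      dist u x1 + dist x1 x2 + dist x2 v \<le> Q * (dist u v + k)"
    and I: "is_interval I"
  shows "infdist x1 (\<gamma> ` I) \<le> M Q k"
proof -
  obtain s t where s: "s \<in> I" "x0 = \<gamma> s" and t: "t \<in> I" "x3 = \<gamma> t" using x0 x3 by auto
  have close: "infdist w (\<gamma> ` I) \<le> M Q k"
    if "s \<in> I" "t \<in> I" "s \<le> t" "0 \<le> b" "improved_quasi_geodesic Q k {0..b} \<eta>"
      "\<eta> 0 = \<gamma> s" "\<eta> b = \<gamma> t" "w \<in> \<eta> ` {0..b}" for s t b \<eta> w
  proof -
    have "infdist w (\<gamma> ` {s..t}) \<le> M Q k"
      using mo that Q k unfolding morse_def by blast
    moreover have "\<gamma> ` {s..t} \<subseteq> \<gamma> ` I"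
      using I that(1,2) by (meson atLeastAtMost_iff image_mono is_interval_1 subsetI)
    then have "infdist w (\<gamma> ` I) \<le> infdist w (\<gamma> ` {s..t})"
      by (rule infdist_mono) (use \<open>s \<le> t\<close> in auto)
    ultimately show ?thesis by linarith
  qed
  show ?thesis
  proof (cases "s \<le> t")
    case True
    obtain b \<eta> where "0 \<le> b" "improved_quasi_geodesic Q k {0..b} \<eta>" "\<eta> 0 = x0" "\<eta> b = x3"
      "x1 \<in> \<eta> ` {0..b}" "x2 \<in> \<eta> ` {0..b}"
      using broken_geodesic[OF G Q k k1 k2 far] by blast
    then show ?thesis using close[of s t b \<eta> x1] s t True by simp
  next
    case False
    have far': "dist u x2 + dist x2 x1 + dist x1 v \<le> Q * (dist u v + k)"
      if "dist x3 u + dist u x2 = dist x3 x2" "dist x1 v + dist v x0 = dist x1 x0" for u v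
    proof -
      have "dist v x1 + dist x1 x2 + dist x2 u \<le> Q * (dist v u + k)"
        using that by (intro far) (simp_all add: dist_commute add.commute)
      then show ?thesis by (simp add: dist_commute add_ac)
    qed
    have k1': "dist x3 x2 + dist x2 x1 \<le> dist x3 x1 + k"
      and k2': "dist x2 x1 + dist x1 x0 \<le> dist x2 x0 + k"
      using k1 k2 by (simp_all add: dist_commute add_ac)
    obtain b \<eta> where "0 \<le> b" "improved_quasi_geodesic Q k {0..b} \<eta>" "\<eta> 0 = x3" "\<eta> b = x0"
      "x2 \<in> \<eta> ` {0..b}" "x1 \<in> \<eta> ` {0..b}"
      using broken_geodesic[OF G Q k k1' k2' far'] by blast
    then show ?thesis using close[of t s b \<eta> x1] s t False by simp
  qed
qed

section \<open>Medians and coarse gates\<close>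

lemma median_space_median:
  fixes x y z :: "'a::metric_space"
  assumes "median_space TYPE('a)"
  obtains m where "dist x m + dist m y = dist x y" "dist y m + dist m z = dist y z"
    "dist z m + dist m x = dist z x"
  using assms unfolding median_space_def by meson

text \<open>For the median \<open>m\<close>, \<open>dist x z\<close> equals
  \<open>dist x p + dist p z - 2 * dist m p\<close>, so only \<open>dist m p\<close> has to be
  bounded. The slack \<open>e\<close> admits almost nearest points.\<close>

lemma near_projection_is_coarse_gate:
  fixes x :: "'a::metric_space"
  assumes med: "median_space TYPE('a)" and G: "geodesic_space TYPE('a)"
    and I: "is_interval I" and mo: "morse M I \<gamma>"
    and p: "p \<in> \<gamma> ` I" and near: "dist x p \<le> infdist x (\<gamma> ` I) + e" and z: "z \<in> \<gamma> ` I"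
  shows "dist x p + dist p z \<le> dist x z + 2 * (M 1 0 + e)"
proof -
  obtain m where m: "dist x m + dist m p = dist x p" "dist p m + dist m z = dist p z"
    "dist z m + dist m x = dist z x"
    using median_space_median[OF med] .
  have "infdist m (\<gamma> ` I) \<le> M 1 0"
  \<comment> \<open>With both inner corners equal to \<open>m\<close> the middle side is a point and
    the path is a geodesic, so the constants are 1 and 0.\<close>
  proof (rule morse_broken_geodesic[OF G mo _ _ p z _ _ _ I, where ?x2.0 = m])
    fix u v
    assume "dist p u + dist u m = dist p m" "dist m v + dist v z = dist m z"
    moreover have "dist p z \<le> dist p u + dist u v + dist v z" by metric
    ultimately show "dist u m + dist m m + dist m v \<le> 1 * (dist u v + 0)" using m by simp
  qed auto
  moreover have "infdist x (\<gamma> ` I) \<le> infdist m (\<gamma> ` I) + dist x m" by (rule infdist_triangle)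
  ultimately have "dist m p \<le> M 1 0 + e" using near m by simp
  then show ?thesis using m by (simp add: dist_commute)
qed

text \<open>The rectangle has height \<open>h\<close> about half its width, so its three sides have
  total length about twice \<open>dist p q\<close>, which gives \<open>Q = 2\<close>. The additive
  constant \<open>3 * E\<close> is the defect at the corner \<open>x'\<close>.\<close>

lemma coarse_gates_close:
  fixes x y :: "'a::metric_space"
  assumes med: "median_space TYPE('a)" and G: "geodesic_space TYPE('a)"
    and I: "is_interval I" and mo: "morse M I \<gamma>" and M0: "0 \<le> M 2 (3 * E)" and E: "0 \<le> E"
    and p: "p \<in> \<gamma> ` I" and q: "q \<in> \<gamma> ` I"
    and gx: "\<And>z. z \<in> \<gamma> ` I \<Longrightarrow> dist x p + dist p z \<le> dist x z + 2 * E"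
    and gy: "\<And>z. z \<in> \<gamma> ` I \<Longrightarrow> dist y q + dist q z \<le> dist y z + 2 * E"
    and xy: "dist x y \<le> dist x p"
  shows "dist p q \<le> 2 * M 2 (3 * E) + 6 * E"
proof (cases "dist p q \<le> 2 * E")
  case True
  then show ?thesis using M0 E by linarith
next
  case False
  define h where "h = (dist p q - 2 * E) / 2"
  have h0: "0 \<le> h" using False by (simp add: h_def)
  have py: "dist y q + dist q p \<le> dist y p + 2 * E" using gy[OF p] .
  obtain m where m: "dist p m + dist m x = dist p x" "dist x m + dist m y = dist x y"
    "dist y m + dist m p = dist y p"
    using median_space_median[OF med] .
  \<comment> \<open>By \<open>xy\<close>, \<open>m\<close> is no farther from \<open>y\<close> than
    from \<open>p\<close>. The value of \<open>h\<close> is what this bound and the gate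
    \<open>q\<close> guarantee as height below \<open>m\<close>.\<close>
  have "dist y p \<le> 2 * dist p m"
    using m xy by (simp add: dist_commute)
  then have "dist q p \<le> 2 * dist p m + 2 * E"
    using py zero_le_dist[of y q] by linarith
  then have "h \<le> dist p m"
    by (simp add: h_def dist_commute)
  obtain g where g: "g 0 = p" "g (dist p m) = m"
    "\<And>s t. 0 \<le> s \<Longrightarrow> s \<le> t \<Longrightarrow> t \<le> dist p m \<Longrightarrow> dist (g s) (g t) = t - s"
    using geodesic_space_unit_speed_path[OF G, of 0 p m] by auto
  define x' where "x' = g h"
  have x': "dist p x' = h" "dist x' m = dist p m - h"
    using g(3)[of 0 h] g(3)[of h "dist p m"] g(1,2) \<open>h \<le> dist p m\<close> h0 by (auto simp: x'_def)
  have x'x: "dist p x' + dist x' x = dist p x"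
    using x' m dist_triangle[of x' x m] dist_triangle[of p x x'] by simp
  have x'y: "dist p x' + dist x' y = dist p y"
    using x' m dist_triangle[of x' y m] dist_triangle[of p y x'] by (simp add: dist_commute)
  \<comment> \<open>As the median of \<open>q\<close>, \<open>y\<close>, \<open>x'\<close>, the
    point \<open>y'\<close> inherits the gate \<open>q\<close> from \<open>y\<close> and makes the
    corner at \<open>y'\<close> exact.\<close>
  obtain y' where y': "dist q y' + dist y' y = dist q y" "dist y y' + dist y' x' = dist y x'"
    "dist x' y' + dist y' q = dist x' q"
    using median_space_median[OF med] .
  \<comment> \<open>Every point between \<open>p\<close> and \<open>x'\<close> also lies between
    \<open>p\<close> and \<open>x\<close>, so it inherits the gate \<open>p\<close> with the same
    constant.\<close>
  have gate_u: "dist u p + dist p z \<le> dist u z + 2 * E"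
    if "dist p u + dist u x' = dist p x'" "z \<in> \<gamma> ` I" for u z
    using gx[OF that(2)] that(1) x'x dist_triangle[of x z u] dist_triangle[of u x x']
    by (simp add: dist_commute)
  have gate_v: "dist v q + dist q z \<le> dist v z + 2 * E"
    if "dist y' v + dist v q = dist y' q" "z \<in> \<gamma> ` I" for v z
    using gy[OF that(2)] that(1) y'(1) dist_triangle[of y z v] dist_triangle[of v y y']
    by (simp add: dist_commute)
  have x'q: "h + dist p q \<le> dist x' q + 2 * E" "dist x' q \<le> h + dist p q"
    using gate_u[of x' q] q x' dist_triangle[of x' q p] by (simp_all add: dist_commute)
  have "dist p y \<le> dist p q + dist q y" by metric
  \<comment> \<open>The median equations express both distances as Gromov products:
    \<open>2 * dist x' y'\<close> is \<open>dist x' q + dist x' y - dist q y\<close>, and similarly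
    for \<open>dist q y'\<close>.\<close>
  then have top: "dist x' y' \<le> dist p q" and q'h: "dist q y' \<le> h + E" "h \<le> dist q y' + E"
    using x'q x' x'y y' py by (simp_all add: dist_commute)
  have "infdist x' (\<gamma> ` I) \<le> M 2 (3 * E)"
  proof (rule morse_broken_geodesic[OF G mo _ _ p q _ _ _ I, where ?x2.0 = y'])
    show "0 \<le> 3 * E" using E by simp
    \<comment> \<open>The gate \<open>q\<close> of \<open>y'\<close> costs \<open>2 * E\<close>, and
      replacing \<open>h\<close> by \<open>dist q y'\<close> costs another \<open>E\<close>.\<close>
    show "dist p x' + dist x' y' \<le> dist p y' + 3 * E"
      using gate_v[of y' p] p top q'h x' by (simp add: dist_commute)
    show "dist x' y' + dist y' q \<le> dist x' q + 3 * E"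
      using y' E by simp
    fix u v
    assume u: "dist p u + dist u x' = dist p x'" and v: "dist y' v + dist v q = dist y' q"
    have "dist u q \<le> dist u v + dist v q" "dist v p \<le> dist u v + dist u p" by metric+
    \<comment> \<open>Adding the two gate inequalities cancels the heights of \<open>u\<close> and
      \<open>v\<close>.\<close>
    then have "dist p q \<le> dist u v + 2 * E"
      using gate_u[OF u q] gate_v[OF v p] by (simp add: dist_commute)
    moreover have "dist u x' + dist x' y' + dist y' v \<le> h + dist p q + (h + E)"
    proof -
      have "dist u x' \<le> h" using u x'(1) zero_le_dist[of p u] by linarith
      moreover have "dist y' v \<le> dist q y'"
        using v zero_le_dist[of v q] dist_commute[of y' q] by linarith
      ultimately show ?thesis using top q'h by linarith
    qed
    ultimately show "dist u x' + dist x' y' + dist y' v \<le> 2 * (dist u v + 3 * E)"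
      using E by (simp add: h_def)
  qed simp
  moreover have "h - 2 * E \<le> infdist x' (\<gamma> ` I)"
  proof -
    have "h - 2 * E \<le> dist x' z" if "z \<in> \<gamma> ` I" for z
      using gate_u[OF _ that, of x'] x'(1) zero_le_dist[of p z] dist_commute[of p x'] dist_self[of x']
      by linarith
    then show ?thesis
      using p by (auto simp: infdist_def intro!: cINF_greatest)
  qed
  ultimately show ?thesis by (simp add: h_def field_simps)
qed

section \<open>Contraction of balls\<close>

theorem theorem1p16:
  assumes "median_space TYPE('a::metric_space)"
    and "geodesic_space TYPE('a)"
  shows "morse_dichotomous TYPE('a)"
  unfolding morse_dichotomous_def
proof (intro allI impI)
  fix M assume gauge: "morse_gauge M"
  \<comment> \<open>The summand 1 is the slack of an almost nearest point to the centre of the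
    ball.\<close>
  define E where "E = M 1 0 + 1"
  define D where "D = 2 * M 2 (3 * E) + 6 * E"
  have E: "0 \<le> E" using gauge unfolding morse_gauge_def E_def by (simp add: add_nonneg_nonneg)
  have M0: "0 \<le> M 2 (3 * E)" using gauge E unfolding morse_gauge_def by simp
  have D0: "0 \<le> D" using E M0 by (simp add: D_def)
  show "\<exists>C. \<forall>I (\<gamma> :: real \<Rightarrow> 'a). geodesic I \<gamma> \<and> morse M I \<gamma> \<longrightarrow> strongly_contracting C I \<gamma>"
  \<comment> \<open>The factor 2 arises because two projected points are compared through an almost
    nearest point to the centre.\<close>
  proof (intro exI[of _ "2 * D"] allI impI)
    fix I and \<gamma> :: "real \<Rightarrow> 'a"
    assume "geodesic I \<gamma> \<and> morse M I \<gamma>"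
    then have I: "is_interval I" and mo: "morse M I \<gamma>" by (auto simp: geodesic_def)
    have gate: "dist x p + dist p z \<le> dist x z + 2 * E"
      if "p \<in> \<gamma> ` I" "dist x p \<le> infdist x (\<gamma> ` I) + 1" "z \<in> \<gamma> ` I" for x p z
      using near_projection_is_coarse_gate[OF assms I mo that] by (simp add: E_def)
    show "strongly_contracting (2 * D) I \<gamma>"
      unfolding strongly_contracting_def
    proof (intro allI impI)
      fix x r assume disj: "ball x r \<inter> \<gamma> ` I = {}"
      let ?P = "\<Union>y\<in>ball x r. closest_points (\<gamma> ` I) y"
      have close: "dist a b \<le> 2 * D" if a: "a \<in> ?P" and b: "b \<in> ?P" for a b
      proof -
        have ne: "\<gamma> ` I \<noteq> {}" using a by (auto simp: closest_points_def)
        \<comment> \<open>\<open>\<gamma> ` I\<close> need not be closed, so the centre of the ball may have no closest point.\<close>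
        obtain p where p: "p \<in> \<gamma> ` I" "dist x p < infdist x (\<gamma> ` I) + 1"
        proof -
          have "(INF z\<in>\<gamma> ` I. dist x z) < infdist x (\<gamma> ` I) + 1"
            using ne by (simp add: infdist_def)
          moreover have "bdd_below (dist x ` \<gamma> ` I)" by (rule bdd_belowI[of _ 0]) auto
          ultimately show thesis using that ne by (auto simp: cINF_less_iff)
        qed
        have proj: "dist p c \<le> D" if c: "c \<in> ?P" for c
        proof -
          obtain y where y: "dist x y < r" "c \<in> \<gamma> ` I" "dist y c = infdist y (\<gamma> ` I)"
            using c by (auto simp: closest_points_def)
          \<comment> \<open>Disjointness places \<open>p\<close> outside the ball, so
            \<open>r \<le> dist x p\<close>.\<close>
          have "dist x y \<le> dist x p" using disj p(1) y(1) by (meson disjoint_iff less_le_trans linear mem_ball not_le)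
          then show ?thesis
            unfolding D_def
            by (intro coarse_gates_close[OF assms I mo M0 E p(1) y(2), of x y] gate)
              (use p y in auto)
        qed
        have "dist a b \<le> dist p a + dist p b" by metric
        then show ?thesis using proj[OF a] proj[OF b] by simp
      qed
      show "bounded ?P \<and> diameter ?P \<le> 2 * D"
      proof
        show "bounded ?P" unfolding bounded_two_points using close by blast
        show "diameter ?P \<le> 2 * D"
        \<comment> \<open>The empty set has diameter 0 by convention, and the supremum bound needs a
          nonempty index set.\<close>
        proof (cases "?P = {}")
          case False
          have "(SUP (a, b)\<in>?P \<times> ?P. dist a b) \<le> 2 * D"
            by (rule cSUP_least) (use False close in auto)
          then show ?thesis unfolding diameter_def by (simp only: False if_False)
        qed (use D0 in \<open>simp add: diameter_def\<close>)
      qed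
    qed
  qed
qed

end
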